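(* Let $\Gamma$ be a finite graph and let $G\leq\mathrm{Aut}(\Gamma)$. Assume that the bivariate chromatic polynomial satisfies $P_{\Lambda}(x,x)=\chi_{\Lambda}(x)$ for every graph $\Lambda$ under consideration (i.e. for all quotient graphs $\Lambda=\Gamma/g$, $g\in G$), where $\chi_\Lambda$ denotes the chromatic polynomial of $\Lambda$. Then $$F_{\Gamma}(G;x,x)=\sum_{H\leq G}\frac1{|H|}\sum_{h\in H}\chi_{\Gamma/h}(x).$$ Equivalently, $$F_{\Gamma}(G;x,x)=\sum_{g\in G}c_G(g)\,\chi_{\Gamma/g}(x),\qquad\text{where } c_G(g):=\sum_{\substack{H\leq G\\ g\in H}}\frac1{|H|}.$$
   Context: Graphs are finite and undirected; loops are allowed and parallel edges are irrelevant (only adjacency matters). For a graph $\Lambda$, the bivariate chromatic polynomial $P_\Lambda(x,y)$ (Dohmen–Pönitz–Tittmann) is the unique polynomial in $x,y$ such that, for all integers $x\ge y\ge 0$, $P_\Lambda(x,y)$ is the number of maps $c:V(\Lambda)\to\{1,\dots,x\}$ such that for every edge $uv$ of $\Lambda$ (including loops, $u=v$) with $c(u)=c(v)$ one has $c(u)>y$. Thus colours $1,\dots,y$ are "proper", colours $y+1,\dots,x$ are "improper", and a vertex carrying a loop can only receive an improper colour. The chromatic polynomial $\chi_\Lambda(x)$ counts, for integers $x\ge0$, the proper vertex colourings of $\Lambda$ with $x$ colours (it is $0$ if $\Lambda$ has a loop). For $g\in G$, the quotient graph $\Gamma/g$ has as vertices the $\langle g\rangle$-orbits on $V(\Gamma)$;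 two distinct orbits are adjacent iff at least one edge of $\Gamma$ joins them, and an orbit carries a loop iff some edge of $\Gamma$ has both endpoints in that orbit. The multiorbital bivariate chromatic polynomial of $\Gamma$ relative to $G$ is $$F_\Gamma(G;x,y):=\sum_{H\le G}\frac1{|H|}\sum_{h\in H}P_{\Gamma/h}(x,y),$$ the outer sum being over all subgroups $H$ of $G$. Identities are polynomial identities with rational coefficients. *)

theory Defs
  imports
    "Graph_Theory.Pair_Digraph"
    "HOL-Algebra.Group_Action"
    "HOL-Algebra.Generated_Groups"
    "HOL-Computational_Algebra.Polynomial"
    "HOL-Library.FuncSet"
begin

text \<open>
  A finite undirected graph with loops allowed and parallel edges ignored is a
  \<^locale>\<open>pair_pseudo_graph\<close>: a finite vertex set \<^term>\<open>pverts \<Lambda>\<close> with a symmetric adjacency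
  relation \<^term>\<open>parcs \<Lambda>\<close> on it. The edge \<open>uv\<close> is the pair of arcs \<open>(u, v)\<close>, \<open>(v, u)\<close>, and a
  loop at \<open>u\<close> is the arc \<open>(u, u)\<close>.
\<close>


subsection \<open>Chromatic and bivariate chromatic polynomials\<close>

definition proper_colourings :: "'a pair_pre_digraph \<Rightarrow> nat \<Rightarrow> ('a \<Rightarrow> nat) set" where
  "proper_colourings \<Lambda> x =
     {c \<in> pverts \<Lambda> \<rightarrow>\<^sub>E {1..x}. \<forall>(u, v) \<in> parcs \<Lambda>. c u \<noteq> c v}"

definition bivariate_colourings :: "'a pair_pre_digraph \<Rightarrow> nat \<Rightarrow> nat \<Rightarrow> ('a \<Rightarrow> nat) set" where
  "bivariate_colourings \<Lambda> x y =
     {c \<in> pverts \<Lambda> \<rightarrow>\<^sub>E {1..x}. \<forall>(u, v) \<in> parcs \<Lambda>. c u = c v \<longrightarrow> y < c u}"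

text \<open>
  A polynomial in \<open>x, y\<close> with rational coefficients is an element of \<^typ>\<open>rat poly poly\<close>: a
  polynomial in \<open>y\<close> (outer variable) whose coefficients are polynomials in \<open>x\<close> (inner variable).
  \<open>diag p\<close> is \<open>p(x, x)\<close>, the polynomial in \<open>x\<close> obtained by substituting \<open>y := x\<close>.
\<close>

definition eval2 :: "rat poly poly \<Rightarrow> rat \<Rightarrow> rat \<Rightarrow> rat" where
  "eval2 p x y = poly (poly p [:y:]) x"

definition diag :: "rat poly poly \<Rightarrow> rat poly" where
  "diag p = poly p [:0, 1:]"

definition chromatic_poly :: "'a pair_pre_digraph \<Rightarrow> rat poly" where
  "chromatic_poly \<Lambda> =
     (THE p. \<forall>x. poly p (of_nat x) = of_nat (card (proper_colourings \<Lambda> x)))"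

definition bivariate_chromatic_poly :: "'a pair_pre_digraph \<Rightarrow> rat poly poly" where
  "bivariate_chromatic_poly \<Lambda> =
     (THE p. \<forall>x y. y \<le> x \<longrightarrow>
        eval2 p (of_nat x) (of_nat y) = of_nat (card (bivariate_colourings \<Lambda> x y)))"


subsection \<open>Automorphisms, quotient graphs and the multiorbital polynomial\<close>

text \<open>As in \<^const>\<open>BijGroup\<close>, permutations of the vertex set are extensional functions on it.\<close>

definition graph_aut :: "'a pair_pre_digraph \<Rightarrow> ('a \<Rightarrow> 'a) monoid" where
  "graph_aut \<Gamma> = BijGroup (pverts \<Gamma>)
     \<lparr>carrier := {f \<in> Bij (pverts \<Gamma>).
        \<forall>u \<in> pverts \<Gamma>. \<forall>v \<in> pverts \<Gamma>. (f u, f v) \<in> parcs \<Gamma> \<longleftrightarrow> (u, v) \<in> parcs \<Gamma>}\<rparr>"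

definition cyclic_orbits :: "'a pair_pre_digraph \<Rightarrow> ('a \<Rightarrow> 'a) \<Rightarrow> 'a set set" where
  "cyclic_orbits \<Gamma> g =
     orbits ((graph_aut \<Gamma>)\<lparr>carrier := generate (graph_aut \<Gamma>) {g}\<rparr>) (pverts \<Gamma>) (\<lambda>f. f)"

definition quotient_graph :: "'a pair_pre_digraph \<Rightarrow> ('a \<Rightarrow> 'a) \<Rightarrow> 'a set pair_pre_digraph" where
  "quotient_graph \<Gamma> g =
     \<lparr>pverts = cyclic_orbits \<Gamma> g,
      parcs = {(A, B). A \<in> cyclic_orbits \<Gamma> g \<and> B \<in> cyclic_orbits \<Gamma> g \<and>
                       (\<exists>u \<in> A. \<exists>v \<in> B. (u, v) \<in> parcs \<Gamma>)}\<rparr>"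

definition subgroups_of :: "'a pair_pre_digraph \<Rightarrow> ('a \<Rightarrow> 'a) set \<Rightarrow> ('a \<Rightarrow> 'a) set set" where
  "subgroups_of \<Gamma> G = {H. subgroup H ((graph_aut \<Gamma>)\<lparr>carrier := G\<rparr>)}"

definition multiorbital_poly :: "'a pair_pre_digraph \<Rightarrow> ('a \<Rightarrow> 'a) set \<Rightarrow> rat poly poly" where
  "multiorbital_poly \<Gamma> G =
     (\<Sum>H \<in> subgroups_of \<Gamma> G.
        smult [:1 / of_nat (card H):]
          (\<Sum>h \<in> H. bivariate_chromatic_poly (quotient_graph \<Gamma> h)))"

definition subgroup_weight :: "'a pair_pre_digraph \<Rightarrow> ('a \<Rightarrow> 'a) set \<Rightarrow> ('a \<Rightarrow> 'a) \<Rightarrow> rat" where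
  "subgroup_weight \<Gamma> G g = (\<Sum>H \<in> {H \<in> subgroups_of \<Gamma> G. g \<in> H}. 1 / of_nat (card H))"


subsection \<open>The definitions are meaningful\<close>

lemma poly_diag: "poly (diag p) t = eval2 p t t"
proof -
  have "poly (poly p q) t = poly (poly p [:poly q t:]) t" for q
    by (induction p) auto
  from this[of "[:0, 1:]"] show ?thesis
    by (simp add: diag_def eval2_def)
qed

lemma poly_eq_on_nats:
  fixes p q :: "rat poly"
  assumes "\<And>n. n \<ge> m \<Longrightarrow> poly p (of_nat n) = poly q (of_nat n)"
  shows "p = q"
proof (rule ccontr)
  assume "p \<noteq> q"
  then have "finite {x. poly (p - q) x = 0}"
    by (intro poly_roots_finite) simp
  moreover have "of_nat ` {m..} \<subseteq> {x. poly (p - q) x = 0}"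
    using assms by auto
  ultimately have "finite ((of_nat :: nat \<Rightarrow> rat) ` {m..})"
    by (rule rev_finite_subset)
  then have "finite {m..}"
    by (rule finite_imageD) (simp add: inj_on_def)
  then show False
    using infinite_Ici by blast
qed

lemma eval2_eq_on_nats:
  assumes "\<And>x y :: nat. y \<le> x \<Longrightarrow>
    eval2 p (of_nat x) (of_nat y) = eval2 q (of_nat x) (of_nat y)"
  shows "p = q"
proof (rule ccontr)
  assume "p \<noteq> q"
  then have "finite {x. poly (p - q) x = 0}"
    by (intro poly_roots_finite) simp
  moreover have "poly p [:of_nat n:] = poly q [:of_nat n:]" for n
    by (rule poly_eq_on_nats[of n]) (use assms in \<open>simp add: eval2_def\<close>)
  then have "(\<lambda>n :: nat. [:of_nat n:]) ` UNIV \<subseteq> {x. poly (p - q) x = 0}"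
    by auto
  ultimately have "finite ((\<lambda>n :: nat. [:of_nat n :: rat:]) ` UNIV)"
    by (rule rev_finite_subset)
  then have "finite (UNIV :: nat set)"
    by (rule finite_imageD) (simp add: inj_on_def)
  then show False
    by simp
qed

lemma count_poly_exists:
  fixes W :: "'a set" and R :: "('a \<times> 'a) set"
  assumes "finite R" "finite W" "R \<subseteq> W \<times> W"
  shows "\<exists>p :: rat poly. \<forall>n. poly p (of_nat n) =
    of_nat (card {c \<in> W \<rightarrow>\<^sub>E {1..n :: nat}. \<forall>(u, v) \<in> R. c u \<noteq> c v})"
  using assms
proof (induction "card R" arbitrary: R W rule: less_induct)
  case less
  note fin = \<open>finite R\<close> \<open>finite W\<close>
  define C where "C = (\<lambda>(W :: 'a set) R n. {c \<in> W \<rightarrow>\<^sub>E {1..n :: nat}. \<forall>(u, v) \<in> R. c u \<noteq> c v})"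
  have finC: "finite (C W' R' n)" if "finite W'" for W' R' n
    unfolding C_def using that by (intro finite_subset[OF _ finite_PiE[of W' "\<lambda>_. {1..n}"]]) auto
  show ?case
  proof (cases "R = {}")
    case True
    then show ?thesis
      using fin by (intro exI[of _ "monom 1 (card W)"]) (simp add: card_PiE poly_monom)
  next
    case False
    then obtain a b where ab: "(a, b) \<in> R" by auto
    show ?thesis
    proof (cases "a = b")
      case True
      then have "C W R n = {}" for n
        using ab by (auto simp: C_def)
      then have "poly 0 (of_nat n) = (of_nat (card (C W R n)) :: rat)" for n
        by simp
      then show ?thesis
        unfolding C_def by blast
    next
      case False
      let ?f = "\<lambda>v. if v = b then a else v"
      define R1 where "R1 = R - {(a, b)}"
      define R2 where "R2 = map_prod ?f ?f ` R1"
      have abW: "a \<in> W" "b \<in> W" using ab less.prems by auto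
      have c1: "card R1 < card R"
        unfolding R1_def using ab fin by (intro card_Diff1_less)
      have c2: "card R2 < card R"
        unfolding R2_def
        by (rule le_less_trans[OF card_image_le c1]) (use fin in \<open>simp add: R1_def\<close>)
      have R1W: "finite R1" "R1 \<subseteq> W \<times> W" "finite R2" "R2 \<subseteq> (W - {b}) \<times> (W - {b})"
        using fin less.prems abW False by (auto simp: R1_def R2_def split: if_splits)
      obtain p1 :: "rat poly" where p1: "\<And>n. poly p1 (of_nat n) = of_nat (card (C W R1 n))"
        using less.hyps[OF c1 R1W(1) fin(2) R1W(2)] unfolding C_def by blast
      obtain p2 :: "rat poly" where p2: "\<And>n. poly p2 (of_nat n) = of_nat (card (C (W - {b}) R2 n))"
        using less.hyps[OF c2 R1W(3) _ R1W(4)] fin unfolding C_def by blast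
      have "card (C W R1 n) = card (C W R n) + card (C (W - {b}) R2 n)" for n
      proof -
        let ?D = "{c \<in> C W R1 n. c a = c b}"
        have split: "C W R1 n = C W R n \<union> ?D" "C W R n \<inter> ?D = {}"
          using ab by (auto simp: C_def R1_def)
        have "bij_betw (\<lambda>c. restrict c (W - {b})) ?D (C (W - {b}) R2 n)"
        proof (rule bij_betw_byWitness[where f' = "\<lambda>c. c(b := c a)"])
          show "\<forall>c\<in>?D. (restrict c (W - {b}))(b := restrict c (W - {b}) a) = c"
            using abW False by (auto simp: C_def fun_eq_iff PiE_def extensional_def)
          show "\<forall>c\<in>C (W - {b}) R2 n. restrict (c(b := c a)) (W - {b}) = c"
            by (auto simp: C_def fun_eq_iff PiE_def extensional_def)
          show "(\<lambda>c. restrict c (W - {b})) ` ?D \<subseteq> C (W - {b}) R2 n"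
          proof safe
            fix c assume c: "c \<in> C W R1 n" "c a = c b"
            have "restrict c (W - {b}) (?f v) = c v" if "v \<in> W" for v
              using that c abW False by auto
            note f = this
            have "restrict c (W - {b}) u \<noteq> restrict c (W - {b}) v" if "(u, v) \<in> R2" for u v
            proof -
              from that obtain u' v' where uv: "(u', v') \<in> R1" "u = ?f u'" "v = ?f v'"
                by (auto simp: R2_def)
              then have "u' \<in> W" "v' \<in> W" using R1W(2) by auto
              moreover have "c u' \<noteq> c v'" using c(1) uv(1) unfolding C_def by blast
              ultimately show ?thesis using f uv(2,3) by metis
            qed
            moreover have "restrict c (W - {b}) \<in> (W - {b}) \<rightarrow>\<^sub>E {1..n}"
              using c(1) by (auto simp: C_def)
            ultimately show "restrict c (W - {b}) \<in> C (W - {b}) R2 n"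
              unfolding C_def by blast
          qed
          show "(\<lambda>c. c(b := c a)) ` C (W - {b}) R2 n \<subseteq> ?D"
          proof safe
            fix c assume c: "c \<in> C (W - {b}) R2 n"
            have f: "c (?f v) = (c(b := c a)) v" for v by auto
            have "(c(b := c a)) u \<noteq> (c(b := c a)) v" if "(u, v) \<in> R1" for u v
            proof -
              have "(?f u, ?f v) \<in> R2" using that by (force simp: R2_def)
              with c have "c (?f u) \<noteq> c (?f v)" unfolding C_def by blast
              then show ?thesis unfolding f .
            qed
            moreover have "c(b := c a) \<in> W \<rightarrow>\<^sub>E {1..n}"
              using c abW False by (auto simp: C_def PiE_def Pi_def extensional_def)
            ultimately show "c(b := c a) \<in> C W R1 n"
              unfolding C_def by blast
          qed (use False in simp)
        qed
        then have "card ?D = card (C (W - {b}) R2 n)"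
          by (rule bij_betw_same_card)
        moreover have "card (C W R1 n) = card (C W R n) + card ?D"
          by (subst split(1), rule card_Un_disjoint) (use finC fin split(2) in auto)
        ultimately show ?thesis by simp
      qed
      then have "poly (p1 - p2) (of_nat n) = of_nat (card (C W R n))" for n
        by (simp add: p1 p2)
      then show ?thesis
        unfolding C_def by blast
    qed
  qed
qed

lemma ex1_chromatic_poly:
  assumes "pair_pseudo_graph \<Lambda>"
  shows "\<exists>!p :: rat poly. \<forall>x. poly p (of_nat x) = of_nat (card (proper_colourings \<Lambda> x))"
proof -
  interpret pair_pseudo_graph \<Lambda> by fact
  have "parcs \<Lambda> \<subseteq> pverts \<Lambda> \<times> pverts \<Lambda>"
    by (auto dest: in_arcsD1 in_arcsD2)
  then show ?thesis
    using count_poly_exists[of "parcs \<Lambda>" "pverts \<Lambda>"]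
    by (intro ex_ex1I) (auto simp: proper_colourings_def intro: poly_eq_on_nats[of 0])
qed

lemma poly_chromatic_poly:
  assumes "pair_pseudo_graph \<Lambda>"
  shows "poly (chromatic_poly \<Lambda>) (of_nat x) = of_nat (card (proper_colourings \<Lambda> x))"
  using theI'[OF ex1_chromatic_poly[OF assms]] unfolding chromatic_poly_def by blast

lemma card_bivariate_colourings:
  assumes "pair_pseudo_graph \<Lambda>" "y \<le> x"
  shows "card (bivariate_colourings \<Lambda> x y) =
    (\<Sum>W \<in> Pow (pverts \<Lambda>).
       card {c \<in> W \<rightarrow>\<^sub>E {1..y}. \<forall>(u, v) \<in> parcs \<Lambda> \<inter> W \<times> W. c u \<noteq> c v} *
       (x - y) ^ card (pverts \<Lambda> - W))"
proof -
  interpret pair_pseudo_graph \<Lambda> by fact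
  let ?V = "pverts \<Lambda>" and ?B = "bivariate_colourings \<Lambda> x y"
  let ?C = "\<lambda>W. {c \<in> W \<rightarrow>\<^sub>E {1..y}. \<forall>(u, v) \<in> parcs \<Lambda> \<inter> W \<times> W. c u \<noteq> c v}"
  let ?L = "\<lambda>c. {v \<in> ?V. c v \<le> y}"
  have finB: "finite ?B"
    unfolding bivariate_colourings_def
    by (intro finite_subset[OF _ finite_PiE[of ?V "\<lambda>_. {1..x}"]]) auto
  have "card ?B = (\<Sum>W \<in> Pow ?V. card {c \<in> ?B. ?L c = W})"
  proof -
    have "?L ` ?B \<subseteq> Pow ?V" by blast
    then have "(\<Sum>W \<in> Pow ?V. \<Sum>c \<in> {c \<in> ?B. ?L c = W}. 1) = (\<Sum>c \<in> ?B. 1 :: nat)"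
      by (intro sum.group finB) (simp_all add: pair_finite_verts)
    then show ?thesis by simp
  qed
  also have "\<dots> = (\<Sum>W \<in> Pow ?V. card (?C W) * (x - y) ^ card (?V - W))"
  proof (rule sum.cong[OF refl])
    fix W assume "W \<in> Pow ?V"
    then have W: "W \<subseteq> ?V" by auto
    let ?D = "(?V - W) \<rightarrow>\<^sub>E {y<..x}"
    let ?S = "{c \<in> ?B. ?L c = W}"
    have "bij_betw (\<lambda>c. (restrict c W, restrict c (?V - W))) ?S (?C W \<times> ?D)"
    proof (rule bij_betw_byWitness[where
            f' = "\<lambda>(c, d) v. if v \<in> W then c v else d v"])
      show "\<forall>c\<in>?S. (case (restrict c W, restrict c (?V - W)) of
          (c, d) \<Rightarrow> \<lambda>v. if v \<in> W then c v else d v) = c"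
        using W by (auto simp: bivariate_colourings_def fun_eq_iff PiE_def extensional_def)
      show "\<forall>cd\<in>?C W \<times> ?D.
          (restrict (case cd of (c, d) \<Rightarrow> \<lambda>v. if v \<in> W then c v else d v) W,
           restrict (case cd of (c, d) \<Rightarrow> \<lambda>v. if v \<in> W then c v else d v) (?V - W)) = cd"
        using W by (auto simp: fun_eq_iff PiE_def extensional_def)
      show "(\<lambda>c. (restrict c W, restrict c (?V - W))) ` ?S \<subseteq> ?C W \<times> ?D"
      proof (rule image_subsetI)
        fix c assume c: "c \<in> ?S"
        then have mem: "\<And>v. v \<in> ?V \<Longrightarrow> 1 \<le> c v \<and> c v \<le> x"
          and low: "\<And>v. v \<in> W \<Longrightarrow> c v \<le> y"
          and high: "\<And>v. v \<in> ?V - W \<Longrightarrow> y < c v"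
          and arc: "\<And>u v. (u, v) \<in> parcs \<Lambda> \<Longrightarrow> c u = c v \<Longrightarrow> y < c u"
          by (auto simp: bivariate_colourings_def PiE_def Pi_def not_le)
        have "restrict c W \<in> ?C W"
          using W mem low arc by (fastforce simp: PiE_def Pi_def)
        moreover have "restrict c (?V - W) \<in> ?D"
          using mem high by auto
        ultimately show "(restrict c W, restrict c (?V - W)) \<in> ?C W \<times> ?D"
          by blast
      qed
      show "(\<lambda>(c, d) v. if v \<in> W then c v else d v) ` (?C W \<times> ?D) \<subseteq> ?S"
      proof (rule image_subsetI, clarify)
        fix c d assume c: "c \<in> W \<rightarrow>\<^sub>E {1..y}" and d: "d \<in> ?D"
          and pr: "\<forall>(u, v) \<in> parcs \<Lambda> \<inter> W \<times> W. c u \<noteq> c v"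
        let ?e = "\<lambda>v. if v \<in> W then c v else d v"
        have c': "1 \<le> c v \<and> c v \<le> y" if "v \<in> W" for v
          using c that by (auto simp: PiE_def Pi_def)
        have d': "y < d v \<and> d v \<le> x" if "v \<in> ?V" "v \<notin> W" for v
          using d that by (auto simp: PiE_def Pi_def)
        have "?e v \<in> {1..x}" if "v \<in> ?V" for v
          using c'[of v] d'[of v] that \<open>y \<le> x\<close> by auto
        moreover have "?e v = undefined" if "v \<notin> ?V" for v
          using d that W by (auto simp: PiE_def extensional_def)
        ultimately have "?e \<in> ?V \<rightarrow>\<^sub>E {1..x}"
          by blast
        moreover have "y < ?e u" if uv: "(u, v) \<in> parcs \<Lambda>" and eq: "?e u = ?e v" for u v
        proof -
          have V: "u \<in> ?V" "v \<in> ?V" using uv by (auto dest: in_arcsD1 in_arcsD2)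
          show ?thesis
            using uv eq pr c'[of u] c'[of v] d'[of u] d'[of v] V
            by (cases "u \<in> W"; cases "v \<in> W") auto
        qed
        moreover have "?L ?e = W"
          using W c' d' by (force simp: not_le)
        ultimately show "?e \<in> ?B \<and> ?L ?e = W"
          unfolding bivariate_colourings_def by blast
      qed
    qed
    then have "card ?S = card (?C W \<times> ?D)"
      by (rule bij_betw_same_card)
    also have "\<dots> = card (?C W) * (x - y) ^ card (?V - W)"
      by (simp add: card_cartesian_product card_PiE)
    finally show "card ?S = card (?C W) * (x - y) ^ card (?V - W)" .
  qed
  finally show ?thesis .
qed

lemma ex1_bivariate_chromatic_poly:
  assumes "pair_pseudo_graph \<Lambda>"
  shows "\<exists>!p. \<forall>x y. y \<le> x \<longrightarrow>
    eval2 p (of_nat x) (of_nat y) = of_nat (card (bivariate_colourings \<Lambda> x y))"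
proof (rule ex_ex1I)
  interpret pair_pseudo_graph \<Lambda> by fact
  let ?V = "pverts \<Lambda>"
  let ?C = "\<lambda>W y. {c \<in> W \<rightarrow>\<^sub>E {1..y :: nat}. \<forall>(u, v) \<in> parcs \<Lambda> \<inter> W \<times> W. c u \<noteq> c v}"
  have "\<exists>q :: rat poly. \<forall>y. poly q (of_nat y) = of_nat (card (?C W y))" if "W \<in> Pow ?V" for W
    using that by (intro count_poly_exists) (auto intro: finite_subset)
  then have "\<forall>W \<in> Pow ?V. \<exists>q :: rat poly. \<forall>y. poly q (of_nat y) = of_nat (card (?C W y))"
    by blast
  from bchoice[OF this] obtain q :: "_ \<Rightarrow> rat poly"
    where q: "\<And>W y. W \<in> Pow ?V \<Longrightarrow> poly (q W) (of_nat y) = of_nat (card (?C W y))"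
    by blast
  define lift :: "rat poly \<Rightarrow> rat poly poly" where "lift = map_poly (\<lambda>a. [:a:])"
  have lift: "poly (lift r) [:t:] = [:poly r t:]" for r t
    unfolding lift_def by (induction r) (auto simp: map_poly_pCons)
  define p where "p = (\<Sum>W \<in> Pow ?V. lift (q W) * [:[:0, 1:], -1:] ^ card (?V - W))"
  have "eval2 p (of_nat x) (of_nat y) = of_nat (card (bivariate_colourings \<Lambda> x y))"
    if "y \<le> x" for x y
    using that
    by (simp add: card_bivariate_colourings[OF assms] eval2_def p_def poly_sum lift q of_nat_diff)
  then show "\<exists>p. \<forall>x y. y \<le> x \<longrightarrow>
      eval2 p (of_nat x) (of_nat y) = of_nat (card (bivariate_colourings \<Lambda> x y))"
    by blast
qed (auto intro: eval2_eq_on_nats)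

lemma eval2_bivariate_chromatic_poly:
  assumes "pair_pseudo_graph \<Lambda>" "y \<le> x"
  shows "eval2 (bivariate_chromatic_poly \<Lambda>) (of_nat x) (of_nat y) =
    of_nat (card (bivariate_colourings \<Lambda> x y))"
  using theI'[OF ex1_bivariate_chromatic_poly[OF assms(1)]] assms(2)
  unfolding bivariate_chromatic_poly_def by blast

lemma group_graph_aut: "group (graph_aut \<Gamma>)"
proof -
  let ?V = "pverts \<Gamma>" and ?A = "carrier (graph_aut \<Gamma>)"
  interpret B: group "BijGroup ?V" by (rule group_BijGroup)
  have sub: "?A \<subseteq> Bij ?V" by (auto simp: graph_aut_def)
  have "subgroup ?A (BijGroup ?V)"
  proof (rule B.subgroupI)
    show "?A \<subseteq> carrier (BijGroup ?V)"
      using sub by (simp add: BijGroup_def)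
    have "(\<lambda>x\<in>?V. x) \<in> ?A"
      by (simp add: graph_aut_def id_Bij)
    then show "?A \<noteq> {}" by blast
  next
    fix f assume f: "f \<in> ?A"
    then have bij: "f \<in> Bij ?V" using sub by blast
    then have inv: "inv\<^bsub>BijGroup ?V\<^esub> f = restrict (inv_into ?V f) ?V"
      by (rule inv_BijGroup)
    have im: "f ` ?V = ?V" using bij by (auto simp: Bij_def bij_betw_def)
    have "(inv_into ?V f u, inv_into ?V f v) \<in> parcs \<Gamma> \<longleftrightarrow> (u, v) \<in> parcs \<Gamma>"
      if "u \<in> ?V" "v \<in> ?V" for u v
    proof -
      have "inv_into ?V f w \<in> ?V" "f (inv_into ?V f w) = w" if "w \<in> ?V" for w
        using that im by (auto intro: inv_into_into f_inv_into_f)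
      note inv_V = this
      have "(f (inv_into ?V f u), f (inv_into ?V f v)) \<in> parcs \<Gamma> \<longleftrightarrow>
          (inv_into ?V f u, inv_into ?V f v) \<in> parcs \<Gamma>"
        using f inv_V(1)[OF that(1)] inv_V(1)[OF that(2)] by (simp add: graph_aut_def)
      then show ?thesis by (simp add: inv_V that)
    qed
    then show "inv\<^bsub>BijGroup ?V\<^esub> f \<in> ?A"
      using restrict_inv_into_Bij[OF bij] by (simp add: inv graph_aut_def)
  next
    fix f g assume fg: "f \<in> ?A" "g \<in> ?A"
    then have bij: "f \<in> Bij ?V" "g \<in> Bij ?V" using sub by blast+
    have "g u \<in> ?V" if "u \<in> ?V" for u
      using that bij by (auto dest: Bij_imp_funcset)
    then have "compose ?V f g \<in> ?A"
      using fg compose_Bij[OF bij] by (simp add: graph_aut_def compose_def)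
    then show "f \<otimes>\<^bsub>BijGroup ?V\<^esub> g \<in> ?A"
      using bij by (simp add: BijGroup_def)
  qed
  then have "group (BijGroup ?V \<lparr>carrier := ?A\<rparr>)"
    by (rule B.subgroup_imp_group)
  then show ?thesis
    by (simp add: graph_aut_def)
qed

lemma pair_pseudo_graph_quotient:
  assumes "pair_pseudo_graph \<Gamma>"
  shows "pair_pseudo_graph (quotient_graph \<Gamma> g)"
proof -
  interpret pair_pseudo_graph \<Gamma> by fact
  have fin: "finite (cyclic_orbits \<Gamma> g)"
    by (simp add: cyclic_orbits_def orbits_def)
  show ?thesis
  proof
    show "finite (pverts (quotient_graph \<Gamma> g))"
      using fin by (simp add: quotient_graph_def)
    show "finite (parcs (quotient_graph \<Gamma> g))"
      by (rule finite_subset[of _ "cyclic_orbits \<Gamma> g \<times> cyclic_orbits \<Gamma> g"])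
        (use fin in \<open>auto simp: quotient_graph_def\<close>)
    have "sym (parcs (quotient_graph \<Gamma> g))"
      using pair_sym_arcs by (auto simp: symmetric_def quotient_graph_def sym_def)
    then show "symmetric (with_proj (quotient_graph \<Gamma> g))"
      by (simp add: symmetric_def)
  qed (auto simp: quotient_graph_def)
qed

end

theory Submission
  imports Defs
begin

text \<open>
  Substituting \<open>y := x\<close> is a ring homomorphism that fixes the rational constants, so it passes
  through the weighted double sum of quotient polynomials defining the multiorbital polynomial
  (\<open>diag_sum\<close>, \<open>diag_smult_const\<close>). Each summand \<open>P(x, x)\<close> that appears belongs to an
  element of \<open>G\<close>, because a subgroup of \<open>G\<close> is a subset of \<open>G\<close>, so the hypothesis turns it into the
  chromatic polynomial of the same quotient. This gives the sum over subgroups. The sum over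
  elements is double counting of the pairs \<open>(H, h)\<close> with \<open>h \<in> H \<le> G\<close>: collecting the terms by
  \<open>h\<close> gives the weight \<open>c\<^sub>G(h)\<close>. The exchange of sums needs \<open>G\<close> to be finite, which
  holds since \<open>G\<close> consists of permutations of a finite vertex set.
\<close>

lemma diag_sum: "diag (\<Sum>i \<in> I. p i) = (\<Sum>i \<in> I. diag (p i))"
  by (simp add: diag_def poly_sum)

lemma diag_smult_const: "diag (smult [:a:] p) = smult a (diag p)"
  by (simp add: diag_def)

lemma finite_carrier_graph_aut:
  assumes "finite (pverts \<Gamma>)"
  shows "finite (carrier (graph_aut \<Gamma>))"
proof (rule finite_subset)
  show "carrier (graph_aut \<Gamma>) \<subseteq> pverts \<Gamma> \<rightarrow>\<^sub>E pverts \<Gamma>"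
    by (auto simp: graph_aut_def Bij_def bij_betw_def PiE_def)
  show "finite (pverts \<Gamma> \<rightarrow>\<^sub>E pverts \<Gamma>)"
    using assms by (intro finite_PiE)
qed

lemma subgroups_of_subset: "H \<in> subgroups_of \<Gamma> G \<Longrightarrow> H \<subseteq> G"
  using subgroup.subset[of H "(graph_aut \<Gamma>)\<lparr>carrier := G\<rparr>"] by (simp add: subgroups_of_def)

lemma smult_sum_right: "smult a (\<Sum>i \<in> I. p i) = (\<Sum>i \<in> I. smult a (p i))"
  by (induction I rule: infinite_finite_induct) (simp_all add: smult_add_right)

text \<open>
  Both sides sum \<open>f h / |H|\<close> over the pairs \<open>(H, h)\<close> with \<open>h \<in> H \<le> G\<close>, the left one collected
  by \<open>H\<close> and the right one by \<open>h\<close>.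
\<close>
lemma sum_over_subgroups_eq_weighted_sum:
  fixes f :: "('a \<Rightarrow> 'a) \<Rightarrow> rat poly"
  assumes "finite G"
  shows "(\<Sum>H \<in> subgroups_of \<Gamma> G. smult (1 / of_nat (card H)) (\<Sum>h \<in> H. f h)) =
    (\<Sum>g \<in> G. smult (subgroup_weight \<Gamma> G g) (f g))"
proof -
  let ?S = "subgroups_of \<Gamma> G" and ?w = "\<lambda>H :: ('a \<Rightarrow> 'a) set. 1 / of_nat (card H) :: rat"
  have "?S \<subseteq> Pow G"
    using subgroups_of_subset by blast
  then have fin: "finite ?S"
    using assms by (simp add: finite_subset)
  have "(\<Sum>H \<in> ?S. smult (?w H) (\<Sum>h \<in> H. f h)) =
      (\<Sum>H \<in> ?S. \<Sum>g \<in> {g \<in> G. g \<in> H}. smult (?w H) (f g))"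
  proof (rule sum.cong[OF refl])
    fix H assume "H \<in> ?S"
    then have "{g \<in> G. g \<in> H} = H"
      using subgroups_of_subset by blast
    then show "smult (?w H) (\<Sum>h \<in> H. f h) = (\<Sum>g \<in> {g \<in> G. g \<in> H}. smult (?w H) (f g))"
      by (simp add: smult_sum_right)
  qed
  also have "\<dots> = (\<Sum>g \<in> G. \<Sum>H \<in> {H \<in> ?S. g \<in> H}. smult (?w H) (f g))"
    by (rule sum.swap_restrict[OF fin assms])
  also have "\<dots> = (\<Sum>g \<in> G. smult (subgroup_weight \<Gamma> G g) (f g))"
    by (simp add: subgroup_weight_def smult_sum)
  finally show ?thesis .
qed

theorem proposition3p13:
  fixes \<Gamma> :: "'a pair_pre_digraph" and G :: "('a \<Rightarrow> 'a) set"
  assumes "pair_pseudo_graph \<Gamma>"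
    and "subgroup G (graph_aut \<Gamma>)"
    and "\<And>g. g \<in> G \<Longrightarrow>
      diag (bivariate_chromatic_poly (quotient_graph \<Gamma> g)) = chromatic_poly (quotient_graph \<Gamma> g)"
  shows "diag (multiorbital_poly \<Gamma> G) =
      (\<Sum>H \<in> subgroups_of \<Gamma> G.
         smult (1 / of_nat (card H)) (\<Sum>h \<in> H. chromatic_poly (quotient_graph \<Gamma> h))) \<and>
    diag (multiorbital_poly \<Gamma> G) =
      (\<Sum>g \<in> G. smult (subgroup_weight \<Gamma> G g) (chromatic_poly (quotient_graph \<Gamma> g)))"
proof -
  interpret pair_pseudo_graph \<Gamma> by fact
  have finG: "finite G"
    using subgroup.subset[OF assms(2)] finite_carrier_graph_aut[OF pair_finite_verts]
    by (rule finite_subset)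
  have "diag (multiorbital_poly \<Gamma> G) =
      (\<Sum>H \<in> subgroups_of \<Gamma> G. smult (1 / of_nat (card H))
         (\<Sum>h \<in> H. diag (bivariate_chromatic_poly (quotient_graph \<Gamma> h))))"
    by (simp only: multiorbital_poly_def diag_sum diag_smult_const)
  also have "\<dots> = (\<Sum>H \<in> subgroups_of \<Gamma> G.
      smult (1 / of_nat (card H)) (\<Sum>h \<in> H. chromatic_poly (quotient_graph \<Gamma> h)))"
    using subgroups_of_subset
    by (intro sum.cong[OF refl] arg_cong[where f = "smult _"] assms(3)) blast
  finally show ?thesis
    by (simp only: sum_over_subgroups_eq_weighted_sum[OF finG])
qed

end
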